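(* Let $\pi\in\mathbb{A}_4$ be of type $(2^2)$, i.e. a product of two disjoint transpositions. Then $\dim\mathfrak{B}(\mathcal{O}_\pi,\rho)=\infty$ for every irreducible complex representation $\rho$ of the centralizer $\mathbb{A}_4^\pi$, where $\mathcal{O}_\pi$ is the conjugacy class of $\pi$ in $\mathbb{A}_4$.
   Context: Let $G$ be a finite group, $s\in G$, $\mathcal{O}$ the conjugacy class of $s$ in $G$, $G^s$ the centralizer of $s$ in $G$, and $\rho:G^s\to GL(V)$ an irreducible complex representation. List $\mathcal{O}=\{t_1=s,\dots,t_M\}$ and choose $g_i\in G$ with $g_isg_i^{-1}=t_i$. The irreducible Yetter-Drinfeld module $M(\mathcal{O},\rho)=\bigoplus_{i=1}^M g_i\otimes V$ over $\mathbb{C}G$ has, writing $g_iv:=g_i\otimes v$, coaction $\delta(g_iv)=t_i\otimes g_iv$ and action $g\cdot(g_iv)=g_j(\gamma\cdot v)$, where $gg_i=g_j\gamma$ with $\gamma\in G^s$. It is a braided vector space with braiding $c(g_iv\otimes g_jw)=t_i\cdot(g_jw)\otimes g_iv$. $\mathfrak{B}(\mathcal{O},\rho)$ denotes the Nichols algebra of this braided vector space. Here $G=\mathbb{A}_4$ and $s=\pi$. *)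

theory Defs
  imports
    "HOL-Analysis.Cartesian_Space"
    "HOL-Algebra.QuotRing"
    "HOL-Algebra.Embedded_Algebras"
    "HOL-Algebra.Sym_Groups"
begin

section \<open>The tensor algebra of a vector space with a finite basis\<close>

text \<open>
  Let \<open>W\<close> be the complex vector space with finite basis \<open>X\<close>.  The words over \<open>X\<close> form a basis of the
  tensor algebra \<open>T(W)\<close>, and an element of \<open>T(W)\<close> is represented by its coefficient function.
  Likewise an element of \<open>T(W) \<otimes> T(W)\<close> is represented by its coefficient function on pairs of words.
\<close>

definition tensor_algebra :: "'x set \<Rightarrow> ('x list \<Rightarrow> complex) ring" where
  "tensor_algebra X =
    \<lparr>carrier = {f. finite {w. f w \<noteq> 0} \<and> {w. f w \<noteq> 0} \<subseteq> lists X},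
     monoid.mult = (\<lambda>f g w. \<Sum>i\<le>length w. f (take i w) * g (drop i w)),
     one = (\<lambda>w. if w = [] then 1 else 0),
     zero = (\<lambda>w. 0),
     add = (\<lambda>f g w. f w + g w)\<rparr>"

definition tensor_scalar :: "complex \<Rightarrow> 'x list \<Rightarrow> complex" where
  "tensor_scalar a = (\<lambda>w. if w = [] then a else 0)"

definition homogeneous_part :: "nat \<Rightarrow> ('x list \<Rightarrow> complex) \<Rightarrow> 'x list \<Rightarrow> complex" where
  "homogeneous_part n f = (\<lambda>w. if length w = n then f w else 0)"

section \<open>The braided bialgebra structure on the tensor algebra\<close>

text \<open>
  A braiding \<open>c\<close> of \<open>W\<close> is given by its coefficients:
  \<open>c(x \<otimes> y) = (\<Sum>y'\<in>X. \<Sum>x'\<in>X. c x y (y', x') \<cdot> y' \<otimes> x')\<close> for \<open>x, y \<in> X\<close>.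
  These coefficients are required to vanish unless \<open>y'\<close> and \<open>x'\<close> belong to \<open>X\<close>.
\<close>

type_synonym 'x braiding = "'x \<Rightarrow> 'x \<Rightarrow> 'x \<times> 'x \<Rightarrow> complex"

text \<open>
  The coefficient of \<open>u \<otimes> z\<close> (\<open>u\<close> a word, \<open>z\<close> a letter) in the image of \<open>x \<otimes> a\<close> under the extension
  \<open>W \<otimes> T(W) \<rightarrow> T(W) \<otimes> W\<close> of the braiding.  For a word \<open>y a\<close> this extension first
  applies \<open>c\<close> to \<open>x \<otimes> y\<close> and then moves the resulting letter past \<open>a\<close>.
\<close>

primrec braid_past :: "'x set \<Rightarrow> 'x braiding \<Rightarrow> 'x list \<Rightarrow> 'x \<Rightarrow> 'x list \<times> 'x \<Rightarrow> complex" where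
  "braid_past X c [] x = (\<lambda>(u, z). if u = [] \<and> z = x then 1 else 0)"
| "braid_past X c (y # a) x = (\<lambda>(u, z). case u of
      [] \<Rightarrow> 0
    | y' # u' \<Rightarrow> \<Sum>x'\<in>X. c x y (y', x') * braid_past X c a x' (u', z))"

text \<open>
  The coproduct of \<open>T(W)\<close> is the algebra map \<open>\<Delta>\<close> into the braided tensor product algebra
  \<open>T(W) \<otimes> T(W)\<close>, whose product is \<open>(m \<otimes> m)(id \<otimes> c \<otimes> id)\<close>, with
  \<open>\<Delta>(x) = x \<otimes> 1 + 1 \<otimes> x\<close> for \<open>x\<close> in \<open>W\<close>.
  On words this means \<open>\<Delta>(x w) = (x \<otimes> 1) \<Delta>(w) + (1 \<otimes> x) \<Delta>(w)\<close>, where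
  \<open>(x \<otimes> 1)(a \<otimes> b) = x a \<otimes> b\<close> and \<open>(1 \<otimes> x)(a \<otimes> b) = c(x \<otimes> a) (1 \<otimes> b)\<close>; the
  two summands below are the coefficients of \<open>u \<otimes> v\<close> in these two terms.
\<close>

primrec comult_word :: "'x set \<Rightarrow> 'x braiding \<Rightarrow> 'x list \<Rightarrow> 'x list \<times> 'x list \<Rightarrow> complex" where
  "comult_word X c [] = (\<lambda>(u, v). if u = [] \<and> v = [] then 1 else 0)"
| "comult_word X c (x # w) = (\<lambda>(u, v).
      (case u of [] \<Rightarrow> 0 | y # u' \<Rightarrow> if y = x then comult_word X c w (u', v) else 0) +
      (case v of [] \<Rightarrow> 0 | z # v' \<Rightarrow>
         \<Sum>a\<in>{a \<in> lists X. length a = length u}.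
           comult_word X c w (a, v') * braid_past X c a x (u, z)))"

definition comult ::
    "'x set \<Rightarrow> 'x braiding \<Rightarrow> ('x list \<Rightarrow> complex) \<Rightarrow> 'x list \<times> 'x list \<Rightarrow> complex" where
  "comult X c f = (\<lambda>p. \<Sum>w | f w \<noteq> 0. f w * comult_word X c w p)"

text \<open>The subspace \<open>I \<otimes> T(W) + T(W) \<otimes> I\<close> of \<open>T(W) \<otimes> T(W)\<close>.\<close>

definition coideal_space ::
    "'x set \<Rightarrow> ('x list \<Rightarrow> complex) set \<Rightarrow> ('x list \<times> 'x list \<Rightarrow> complex) set" where
  "coideal_space X I = {(\<lambda>(u, v). \<Sum>i<n. a i u * b i v) | (n::nat) a b.
     \<forall>i<n. (a i \<in> I \<and> b i \<in> carrier (tensor_algebra X)) \<or>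
           (a i \<in> carrier (tensor_algebra X) \<and> b i \<in> I)}"

section \<open>Nichols algebras\<close>

text \<open>
  The Nichols algebra is the quotient of \<open>T(W)\<close> by the sum of all homogeneous ideals that
  are coideals and are contained in the part of degree at least two.  The counit
  vanishes on such ideals automatically.
\<close>

definition nichols_relation_ideals :: "'x set \<Rightarrow> 'x braiding \<Rightarrow> ('x list \<Rightarrow> complex) set set" where
  "nichols_relation_ideals X c = {I.
     ideal I (tensor_algebra X) \<and>
     (\<forall>f\<in>I. \<forall>n. homogeneous_part n f \<in> I) \<and>
     (\<forall>f\<in>I. \<forall>w. length w < 2 \<longrightarrow> f w = 0) \<and>
     comult X c ` I \<subseteq> coideal_space X I}"

definition nichols_ideal :: "'x set \<Rightarrow> 'x braiding \<Rightarrow> ('x list \<Rightarrow> complex) set" where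
  "nichols_ideal X c = Idl\<^bsub>tensor_algebra X\<^esub> (\<Union>(nichols_relation_ideals X c))"

definition nichols_algebra :: "'x set \<Rightarrow> 'x braiding \<Rightarrow> ('x list \<Rightarrow> complex) set ring" where
  "nichols_algebra X c = tensor_algebra X Quot nichols_ideal X c"

text \<open>The dimension of a subset of a ring is taken over a subfield of that ring, here the scalars.\<close>

definition nichols_scalars :: "'x set \<Rightarrow> 'x braiding \<Rightarrow> ('x list \<Rightarrow> complex) set set" where
  "nichols_scalars X c =
     range (\<lambda>a. nichols_ideal X c +>\<^bsub>tensor_algebra X\<^esub> tensor_scalar a)"

definition nichols_infinite_dim :: "'x set \<Rightarrow> 'x braiding \<Rightarrow> bool" where
  "nichols_infinite_dim X c \<longleftrightarrow>
     ring.infinite_dimension (nichols_algebra X c) (nichols_scalars X c)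
       (carrier (nichols_algebra X c))"

section \<open>Irreducible Yetter-Drinfeld modules over a group algebra\<close>

definition conj_class :: "('g, 'm) monoid_scheme \<Rightarrow> 'g \<Rightarrow> 'g set" where
  "conj_class G s = {g \<otimes>\<^bsub>G\<^esub> s \<otimes>\<^bsub>G\<^esub> inv\<^bsub>G\<^esub> g | g. g \<in> carrier G}"

definition centralizer :: "('g, 'm) monoid_scheme \<Rightarrow> 'g \<Rightarrow> 'g set" where
  "centralizer G s = {h \<in> carrier G. h \<otimes>\<^bsub>G\<^esub> s = s \<otimes>\<^bsub>G\<^esub> h}"

text \<open>
  Representations of a subgroup \<open>H\<close> of \<open>G\<close> on \<open>complex ^ 'n\<close>, with \<open>\<rho> h\<close> acting by \<open>*v\<close>.
  Irreducible representations of a finite group are finite-dimensional and nonzero.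
\<close>

definition linear_rep ::
    "('g, 'm) monoid_scheme \<Rightarrow> 'g set \<Rightarrow> ('g \<Rightarrow> complex ^ 'n ^ 'n::finite) \<Rightarrow> bool" where
  "linear_rep G H \<rho> \<longleftrightarrow>
     (\<forall>h\<in>H. invertible (\<rho> h)) \<and> (\<forall>h\<in>H. \<forall>k\<in>H. \<rho> (h \<otimes>\<^bsub>G\<^esub> k) = \<rho> h ** \<rho> k)"

definition irreducible_rep ::
    "('g, 'm) monoid_scheme \<Rightarrow> 'g set \<Rightarrow> ('g \<Rightarrow> complex ^ 'n ^ 'n::finite) \<Rightarrow> bool" where
  "irreducible_rep G H \<rho> \<longleftrightarrow>
     linear_rep G H \<rho> \<and>
     (\<forall>U. vec.subspace U \<and> (\<forall>h\<in>H. \<forall>v\<in>U. \<rho> h *v v \<in> U) \<longrightarrow> U = {0} \<or> U = UNIV)"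

definition conj_section :: "('g, 'm) monoid_scheme \<Rightarrow> 'g \<Rightarrow> ('g \<Rightarrow> 'g) \<Rightarrow> bool" where
  "conj_section G s g \<longleftrightarrow>
     (\<forall>t \<in> conj_class G s. g t \<in> carrier G \<and> g t \<otimes>\<^bsub>G\<^esub> s \<otimes>\<^bsub>G\<^esub> inv\<^bsub>G\<^esub> (g t) = t)"

text \<open>
  The pair \<open>(t, k)\<close> stands for the basis vector \<open>g t \<otimes> e\<^sub>k\<close> of \<open>M(\<O>, \<rho>)\<close>, where
  \<open>e\<^sub>k\<close> is the \<open>k\<close>-th standard basis vector of \<open>complex ^ 'n\<close>.  Its coaction is
  \<open>(t, k) \<mapsto> t \<otimes> (t, k)\<close>.
\<close>

definition yd_basis :: "('g, 'm) monoid_scheme \<Rightarrow> 'g \<Rightarrow> ('g \<times> 'n) set" where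
  "yd_basis G s = conj_class G s \<times> UNIV"

text \<open>
  The coefficient of \<open>(u, l)\<close> in \<open>h \<cdot> (t, k)\<close>.  Since \<open>h (g t) = (g u) \<gamma>\<close> with \<open>\<gamma>\<close> in the
  centralizer for exactly one \<open>u\<close>, the coefficients for all other \<open>u\<close> are zero.
\<close>

definition yd_action :: "('g, 'm) monoid_scheme \<Rightarrow> 'g \<Rightarrow> ('g \<Rightarrow> 'g) \<Rightarrow>
    ('g \<Rightarrow> complex ^ 'n ^ 'n::finite) \<Rightarrow> 'g \<Rightarrow> 'g \<times> 'n \<Rightarrow> 'g \<times> 'n \<Rightarrow> complex" where
  "yd_action G s g \<rho> h = (\<lambda>(t, k) (u, l).
     let \<gamma> = inv\<^bsub>G\<^esub> (g u) \<otimes>\<^bsub>G\<^esub> (h \<otimes>\<^bsub>G\<^esub> g t)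
     in if u \<in> conj_class G s \<and> \<gamma> \<in> centralizer G s then \<rho> \<gamma> $ l $ k else 0)"

text \<open>The braiding \<open>c(x \<otimes> y) = t \<cdot> y \<otimes> x\<close> for \<open>x\<close> of degree \<open>t = fst x\<close>.\<close>

definition yd_braiding :: "('g, 'm) monoid_scheme \<Rightarrow> 'g \<Rightarrow> ('g \<Rightarrow> 'g) \<Rightarrow>
    ('g \<Rightarrow> complex ^ 'n ^ 'n::finite) \<Rightarrow> ('g \<times> 'n) braiding" where
  "yd_braiding G s g \<rho> x y = (\<lambda>(y', x').
     if x' = x then yd_action G s g \<rho> (fst x) y y' else 0)"

section \<open>Cycle type\<close>

definition double_transposition_type :: "nat \<Rightarrow> (nat \<Rightarrow> nat) \<Rightarrow> bool" where
  "double_transposition_type n p \<longleftrightarrow>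
     (\<exists>a b c d. {a, b, c, d} \<subseteq> {1..n} \<and> distinct [a, b, c, d] \<and>
        p = Transposition.transpose a b \<circ> Transposition.transpose c d)"

end

(*
  The centralizer of \<pi> is the Klein four-group, so an irreducible \<rho> acts on it by signs and the
  braiding is diagonal, say with matrix q.  The constant term of every iterated skew derivative
  of an element of the Nichols ideal vanishes, so it suffices to find elements of T(W) of arbitrarily
  large degree that some iterated skew derivation maps to a nonzero scalar.  If \<rho>(\<pi>) = 1, powers
  of a letter z with q(z,z) = 1 will do.  If \<rho>(\<pi>) = -1, the three elements x, y, t of the
  conjugacy class span a braiding of affine Cartan type A_2^(1) at q = -1: the imaginary root
  x + y + t braids trivially with every letter, and the powers of the braided commutator
  [x, [y, t]] behave like the powers of a variable under an ordinary derivation.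
*)
theory Submission
  imports Defs
begin

section \<open>The tensor algebra as a ring\<close>

text \<open>If \<rho>(\<pi>) = -1, the other two elements of the class act by scalars \<alpha> and
  \<beta> with \<alpha>\<beta> = -1, because \<pi> is their product. Each row of q consists of -1,
  \<alpha>, \<beta> in some order, so its product is 1; this is why x + y + t braids trivially. For
  two different vertices, q(i,j) q(j,i) = \<alpha>\<beta> = -1 = q(i,i), so any two are joined as in
  A_2 and the diagram is a triangle. The Nichols ideal is known only through the ideals that
  generate it, so the proof works with functionals instead of relations: the constant term after m
  skew derivations sees only degree m and vanishes on the ideal. An element on which such a
  functional is nonzero is therefore not congruent to anything of degree below m.\<close>

definition conv :: "('x list \<Rightarrow> complex) \<Rightarrow> ('x list \<Rightarrow> complex) \<Rightarrow> 'x list \<Rightarrow> complex" where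
  "conv f g = (\<lambda>w. \<Sum>i\<le>length w. f (take i w) * g (drop i w))"

lemma conv_Nil [simp]: "conv f g [] = f [] * g []"
  by (simp add: conv_def)

text \<open>The cut before the first letter is split off. This recursion replaces sums over cut
  positions in later inductions on words; it changes the left factor, hence
  \<open>arbitrary: f\<close>.\<close>

lemma conv_Cons: "conv f g (x # w) = f [] * g (x # w) + conv (\<lambda>u. f (x # u)) g w"
  by (simp add: conv_def sum.atMost_Suc_shift del: sum.atMost_Suc)

lemma conv_add_left: "conv (\<lambda>w. f w + g w) h = (\<lambda>w. conv f h w + conv g h w)"
  by (simp add: conv_def algebra_simps sum.distrib)

lemma conv_add_right: "conv h (\<lambda>w. f w + g w) = (\<lambda>w. conv h f w + conv h g w)"
  by (simp add: conv_def algebra_simps sum.distrib)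

lemma conv_scale_left: "conv (\<lambda>w. a * f w) h = (\<lambda>w. a * conv f h w)"
  by (simp add: conv_def sum_distrib_left mult.assoc)

lemma conv_scale_right: "conv h (\<lambda>w. a * f w) = (\<lambda>w. a * conv h f w)"
  by (simp add: conv_def sum_distrib_left algebra_simps)

lemma conv_assoc: "conv (conv f g) h = conv f (conv g h)"
proof
  show "conv (conv f g) h w = conv f (conv g h) w" for w
  proof (induction w arbitrary: f)
    case (Cons x w)
    then show ?case
      by (simp add: conv_Cons conv_add_left conv_scale_left algebra_simps)
  qed simp
qed

lemma conv_zero_left [simp]: "conv (\<lambda>w. 0) f = (\<lambda>w. 0)"
  by (simp add: conv_def)

lemma conv_zero_right [simp]: "conv f (\<lambda>w. 0) = (\<lambda>w. 0)"
  by (simp add: conv_def)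

lemma conv_tensor_scalar_left: "conv (tensor_scalar a) f = (\<lambda>w. a * f w)"
proof
  show "conv (tensor_scalar a) f w = a * f w" for w
    by (cases w) (simp_all add: conv_Cons tensor_scalar_def)
qed

lemma conv_tensor_scalar_right: "conv f (tensor_scalar a) = (\<lambda>w. a * f w)"
proof
  show "conv f (tensor_scalar a) w = a * f w" for w
  proof (induction w arbitrary: f)
    case Nil
    then show ?case by (simp add: tensor_scalar_def)
  next
    case (Cons x w)
    then show ?case by (simp add: conv_Cons) (simp add: tensor_scalar_def)
  qed
qed

lemma carrier_tensor_algebra:
  "f \<in> carrier (tensor_algebra X) \<longleftrightarrow> finite {w. f w \<noteq> 0} \<and> (\<forall>w. f w \<noteq> 0 \<longrightarrow> w \<in> lists X)"
  by (auto simp: tensor_algebra_def)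

lemma tensor_algebra_simps [simp]:
  "monoid.mult (tensor_algebra X) = conv"
  "monoid.one (tensor_algebra X) = tensor_scalar 1"
  "ring.zero (tensor_algebra X) = (\<lambda>w. 0)"
  "ring.add (tensor_algebra X) = (\<lambda>f g w. f w + g w)"
  by (simp_all add: tensor_algebra_def conv_def tensor_scalar_def fun_eq_iff)

lemma tensor_conv_closed:
  assumes "f \<in> carrier (tensor_algebra X)" "g \<in> carrier (tensor_algebra X)"
  shows "conv f g \<in> carrier (tensor_algebra X)"
proof -
  have *: "\<exists>u v. w = u @ v \<and> f u \<noteq> 0 \<and> g v \<noteq> 0" if "conv f g w \<noteq> 0" for w
  proof -
    have "\<exists>i. f (take i w) * g (drop i w) \<noteq> 0"
      using that sum.neutral[of "{..length w}" "\<lambda>i. f (take i w) * g (drop i w)"]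
      unfolding conv_def by blast
    then obtain i where "f (take i w) \<noteq> 0" "g (drop i w) \<noteq> 0"
      by auto
    then show ?thesis
      by (intro exI[of _ "take i w"] exI[of _ "drop i w"]) simp
  qed
  then have "{w. conv f g w \<noteq> 0} \<subseteq> (\<lambda>(u, v). u @ v) ` ({u. f u \<noteq> 0} \<times> {v. g v \<noteq> 0})"
    by fast
  then have "finite {w. conv f g w \<noteq> 0}"
    using assms by (auto simp: carrier_tensor_algebra intro: finite_surj)
  moreover have "w \<in> lists X" if "conv f g w \<noteq> 0" for w
  proof -
    obtain u v where "w = u @ v" "f u \<noteq> 0" "g v \<noteq> 0"
      using * \<open>conv f g w \<noteq> 0\<close> by blast
    then show ?thesis
      using assms by (simp add: carrier_tensor_algebra del: in_lists_conv_set)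
  qed
  ultimately show ?thesis
    by (simp add: carrier_tensor_algebra del: in_lists_conv_set)
qed

lemma tensor_add_closed:
  assumes "f \<in> carrier (tensor_algebra X)" "g \<in> carrier (tensor_algebra X)"
  shows "(\<lambda>w. f w + g w) \<in> carrier (tensor_algebra X)"
proof -
  have "{w. f w + g w \<noteq> 0} \<subseteq> {w. f w \<noteq> 0} \<union> {w. g w \<noteq> 0}"
    by auto
  then show ?thesis
    using assms by (auto simp: carrier_tensor_algebra intro: finite_subset)
qed

lemma tensor_zero_closed: "(\<lambda>w. 0) \<in> carrier (tensor_algebra X)"
  by (simp add: carrier_tensor_algebra)

lemma tensor_scale_closed:
  assumes "f \<in> carrier (tensor_algebra X)"
  shows "(\<lambda>w. a * f w) \<in> carrier (tensor_algebra X)"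
proof -
  have "{w. a * f w \<noteq> 0} \<subseteq> {w. f w \<noteq> 0}"
    by auto
  then show ?thesis
    using assms by (auto simp: carrier_tensor_algebra intro: finite_subset)
qed

lemma tensor_scalar_closed: "tensor_scalar a \<in> carrier (tensor_algebra X)"
proof -
  have "{w. tensor_scalar a w \<noteq> 0} \<subseteq> {[]}"
    by (auto simp: tensor_scalar_def)
  then show ?thesis
    by (auto simp: carrier_tensor_algebra intro: finite_subset)
qed

lemma ring_tensor_algebra: "ring (tensor_algebra X)"
proof (rule ringI)
  show "abelian_group (tensor_algebra X)"
  proof (rule abelian_groupI)
    fix f assume "f \<in> carrier (tensor_algebra X)"
    then show "\<exists>g\<in>carrier (tensor_algebra X). g \<oplus>\<^bsub>tensor_algebra X\<^esub> f = \<zero>\<^bsub>tensor_algebra X\<^esub>"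
      using tensor_scale_closed[of f X "-1"] by (intro bexI[of _ "\<lambda>w. -1 * f w"]) auto
  qed (auto simp: tensor_add_closed tensor_zero_closed add_ac)
  show "Group.monoid (tensor_algebra X)"
    by (rule monoidI) (simp_all add: tensor_conv_closed tensor_scalar_closed conv_assoc
        conv_tensor_scalar_left conv_tensor_scalar_right)
qed (simp_all add: conv_add_left conv_add_right)

section \<open>Skew derivations for a diagonal braiding\<close>

definition diagonal_braiding :: "'x set \<Rightarrow> 'x braiding \<Rightarrow> ('x \<Rightarrow> 'x \<Rightarrow> complex) \<Rightarrow> bool" where
  "diagonal_braiding X c q \<longleftrightarrow>
     (\<forall>x\<in>X. \<forall>y\<in>X. \<forall>y' x'. c x y (y', x') = (if y' = y \<and> x' = x then q x y else 0))"

text \<open>The scalar produced when the diagonal braiding moves \<open>z\<close> rightwards past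
  the whole word \<open>w\<close>.\<close>

definition weight :: "('x \<Rightarrow> 'x \<Rightarrow> complex) \<Rightarrow> 'x \<Rightarrow> 'x list \<Rightarrow> complex" where
  "weight q z w = prod_list (map (q z) w)"

lemma weight_simps [simp]:
  "weight q z [] = 1" "weight q z (x # w) = q z x * weight q z w"
  by (simp_all add: weight_def)

text \<open>The coefficient of \<open>\<Delta>(f)\<close> in \<open>T(W) \<otimes> z\<close>.\<close>

primrec skew_deriv ::
    "('x \<Rightarrow> 'x \<Rightarrow> complex) \<Rightarrow> 'x \<Rightarrow> ('x list \<Rightarrow> complex) \<Rightarrow> 'x list \<Rightarrow> complex" where
  skew_deriv_Nil: "skew_deriv q z f [] = f [z]"
| skew_deriv_Cons: "skew_deriv q z f (y # u) =
     f (z # y # u) * weight q z (y # u) + skew_deriv q z (\<lambda>v. f (y # v)) u"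

declare skew_deriv.simps [simp del]

text \<open>The braiding sends z \<otimes> f to \<open>twist q z f\<close> \<otimes> z.\<close>

definition twist :: "('x \<Rightarrow> 'x \<Rightarrow> complex) \<Rightarrow> 'x \<Rightarrow> ('x list \<Rightarrow> complex) \<Rightarrow> 'x list \<Rightarrow> complex" where
  "twist q z f = (\<lambda>w. weight q z w * f w)"

lemma skew_deriv_add:
  "skew_deriv q z (\<lambda>w. f w + g w) = (\<lambda>w. skew_deriv q z f w + skew_deriv q z g w)"
proof
  show "skew_deriv q z (\<lambda>w. f w + g w) w = skew_deriv q z f w + skew_deriv q z g w" for w
    by (induction w arbitrary: f g) (simp_all add: skew_deriv_Nil skew_deriv_Cons algebra_simps)
qed

lemma skew_deriv_scale: "skew_deriv q z (\<lambda>w. a * f w) = (\<lambda>w. a * skew_deriv q z f w)"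
proof
  show "skew_deriv q z (\<lambda>w. a * f w) w = a * skew_deriv q z f w" for w
    by (induction w arbitrary: f) (simp_all add: skew_deriv_Nil skew_deriv_Cons algebra_simps)
qed

lemma skew_deriv_zero [simp]: "skew_deriv q z (\<lambda>w. 0) = (\<lambda>w. 0)"
  using skew_deriv_scale[of q z 0] by simp

lemma skew_deriv_sum: "skew_deriv q z (\<lambda>w. \<Sum>a\<in>A. f a w) = (\<lambda>w. \<Sum>a\<in>A. skew_deriv q z (f a) w)"
  by (induction A rule: infinite_finite_induct) (simp_all add: skew_deriv_add)

lemma skew_deriv_tensor_scalar [simp]: "skew_deriv q z (tensor_scalar a) = (\<lambda>w. 0)"
proof
  show "skew_deriv q z (tensor_scalar a) w = 0" for w
    by (cases w) (simp_all add: skew_deriv_Nil skew_deriv_Cons tensor_scalar_def)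
qed

lemma twist_conv: "twist q z (conv f g) = conv (twist q z f) (twist q z g)"
proof
  have "weight q z w * conv f g w = conv (\<lambda>w. weight q z w * f w) (\<lambda>w. weight q z w * g w) w" for w
  proof (induction w arbitrary: f)
    case (Cons x w)
    have "conv (\<lambda>u. weight q z (x # u) * f (x # u)) (\<lambda>w. weight q z w * g w) w =
        q z x * (weight q z w * conv (\<lambda>u. f (x # u)) g w)"
      unfolding Cons by (simp add: conv_scale_left mult.assoc)
    then show ?case
      by (simp add: conv_Cons algebra_simps)
  qed simp
  then show "twist q z (conv f g) w = conv (twist q z f) (twist q z g) w" for w
    by (simp add: twist_def)
qed

text \<open>In \<Delta>(f) \<Delta>(g) a right tensor factor \<open>z\<close> comes either from
  \<open>g\<close>, or from \<open>f\<close>; in the latter case it has to be braided past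
  \<open>g\<close>, which twists \<open>g\<close>.\<close>

lemma skew_deriv_conv:
  "skew_deriv q z (conv f g) =
    (\<lambda>w. conv f (skew_deriv q z g) w + conv (skew_deriv q z f) (twist q z g) w)"
proof
  show "skew_deriv q z (conv f g) w = conv f (skew_deriv q z g) w + conv (skew_deriv q z f) (twist q z g) w" for w
  proof (induction w arbitrary: f)
    case Nil
    then show ?case by (simp add: skew_deriv_Nil conv_Cons twist_def)
  next
    case (Cons y u)
    \<comment> \<open>The term in which a leading \<open>z\<close> of the left factor is removed:
      multiplicativity of \<open>twist\<close> distributes its weight over the two sides of the
      cut.\<close>
    have "weight q z (y # u) * conv (\<lambda>w. f (z # w)) g (y # u) =
        conv (twist q z (\<lambda>w. f (z # w))) (twist q z g) (y # u)"
      using fun_cong[OF twist_conv[of q z "\<lambda>w. f (z # w)" g], of "y # u"]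
      by (simp only: twist_def)
    then have *: "weight q z (y # u) * conv (\<lambda>w. f (z # w)) g (y # u) =
        f [z] * twist q z g (y # u) +
        conv (\<lambda>v. f (z # y # v) * weight q z (y # v)) (twist q z g) u"
      by (simp add: conv_Cons[of "twist q z _"]) (simp add: twist_def mult.commute)
    have "skew_deriv q z (conv f g) (y # u) =
        f [] * (g (z # y # u) * weight q z (y # u)) +
        weight q z (y # u) * conv (\<lambda>w. f (z # w)) g (y # u) +
        (f [] * skew_deriv q z (\<lambda>v. g (y # v)) u + skew_deriv q z (conv (\<lambda>v. f (y # v)) g) u)"
      by (simp add: skew_deriv_Cons conv_Cons[of f] skew_deriv_add skew_deriv_scale algebra_simps del: weight_simps)
    then show ?case
      unfolding Cons * by (simp add: conv_Cons[of f] conv_Cons[of "skew_deriv q z f"] skew_deriv_Cons skew_deriv_Nil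
          conv_add_left algebra_simps del: weight_simps)
  qed
qed

text \<open>Deleting a letter \<open>x\<close> from a word deletes the factor \<open>q y x\<close>
  from its weight.\<close>

lemma skew_deriv_twist:
  "skew_deriv q x (twist q y f) = (\<lambda>w. q y x * twist q y (skew_deriv q x f) w)"
proof
  have "skew_deriv q x (\<lambda>w. weight q y w * f w) w = q y x * weight q y w * skew_deriv q x f w" for w
  proof (induction w arbitrary: f)
    case (Cons a w)
    show ?case
      using Cons[of "\<lambda>v. f (a # v)"]
      by (simp add: skew_deriv_Cons skew_deriv_scale algebra_simps)
  qed (simp add: skew_deriv_Nil)
  then show "skew_deriv q x (twist q y f) w = q y x * twist q y (skew_deriv q x f) w" for w
    by (simp add: twist_def)
qed

section \<open>Iterated skew derivations and their common radical\<close>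

primrec skew_derivs :: "('x \<Rightarrow> 'x \<Rightarrow> complex) \<Rightarrow> 'x list \<Rightarrow> ('x list \<Rightarrow> complex) \<Rightarrow> 'x list \<Rightarrow> complex" where
  "skew_derivs q [] f = f"
| "skew_derivs q (z # v) f = skew_derivs q v (skew_deriv q z f)"

lemma skew_derivs_append: "skew_derivs q (u @ v) f = skew_derivs q v (skew_derivs q u f)"
  by (induction u arbitrary: f) simp_all

lemma skew_derivs_add:
  "skew_derivs q v (\<lambda>w. f w + g w) = (\<lambda>w. skew_derivs q v f w + skew_derivs q v g w)"
  by (induction v arbitrary: f g) (simp_all add: skew_deriv_add)

lemma skew_derivs_scale: "skew_derivs q v (\<lambda>w. a * f w) = (\<lambda>w. a * skew_derivs q v f w)"
  by (induction v arbitrary: f) (simp_all add: skew_deriv_scale)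

lemma skew_derivs_zero [simp]: "skew_derivs q v (\<lambda>w. 0) = (\<lambda>w. 0)"
  by (induction v) simp_all

text \<open>The scalar is the product of \<open>q y x\<close> over the letters \<open>x\<close> of
  \<open>v\<close>. Its existence suffices to carry vanishing over from \<open>f\<close> to its
  twist.\<close>

lemma skew_derivs_twist:
  "\<exists>a. skew_derivs q v (twist q y f) = (\<lambda>w. a * twist q y (skew_derivs q v f) w)"
proof (induction v arbitrary: f)
  case Nil
  show ?case by (intro exI[of _ 1]) simp
next
  case (Cons x v)
  obtain a where "skew_derivs q v (twist q y (skew_deriv q x f)) =
      (\<lambda>w. a * twist q y (skew_derivs q v (skew_deriv q x f)) w)"
    using Cons by blast
  then show ?case
    by (intro exI[of _ "q y x * a"]) (simp add: skew_deriv_twist skew_derivs_scale mult.assoc)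
qed

text \<open>A skew derivation lowers the degree by exactly one.\<close>

lemma skew_deriv_local:
  assumes "\<And>w. length w = Suc (length u) \<Longrightarrow> f w = 0"
  shows "skew_deriv q z f u = 0"
  using assms by (induction u arbitrary: f) (simp_all add: skew_deriv_Nil skew_deriv_Cons)

lemma skew_derivs_local:
  assumes "\<And>w. length w = length u + length v \<Longrightarrow> f w = 0"
  shows "skew_derivs q v f u = 0"
  using assms
proof (induction v arbitrary: f)
  case (Cons z v)
  then show ?case by (auto intro!: Cons.IH skew_deriv_local)
qed simp

text \<open>Classically the defining ideal of the Nichols algebra of a diagonal braiding. A lower
  bound on the dimension calls for the inclusion of the Nichols ideal in it.\<close>

definition skew_radical :: "'x set \<Rightarrow> ('x \<Rightarrow> 'x \<Rightarrow> complex) \<Rightarrow> ('x list \<Rightarrow> complex) set" where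
  "skew_radical X q = {f \<in> carrier (tensor_algebra X). \<forall>v\<in>lists X. skew_derivs q v f [] = 0}"

text \<open>By the Leibniz rule, the left factor stays or is replaced by a derivative, and both
  satisfy the hypothesis; the right factor is arbitrary throughout the induction.\<close>

lemma skew_derivs_conv_Nil_left:
  assumes "v \<in> lists X" "\<And>v. v \<in> lists X \<Longrightarrow> skew_derivs q v f [] = 0"
  shows "skew_derivs q v (conv f g) [] = 0"
  using assms
proof (induction v arbitrary: f g)
  case Nil
  then show ?case using Nil.prems[of "[]"] by simp
next
  case (Cons z v)
  have "skew_derivs q v (conv f (skew_deriv q z g)) [] = 0"
    using Cons by (intro Cons.IH) auto
  moreover have "skew_derivs q v (conv (skew_deriv q z f) (twist q z g)) [] = 0"
    using Cons.hyps Cons.prems[of "z # _"] by (intro Cons.IH) auto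
  ultimately show ?case
    by (simp add: skew_deriv_conv skew_derivs_add)
qed

text \<open>Here the right factor may also be twisted, which preserves the hypothesis since twisting
  only rescales constant terms of derivatives.\<close>

lemma skew_derivs_conv_Nil_right:
  assumes "v \<in> lists X" "\<And>v. v \<in> lists X \<Longrightarrow> skew_derivs q v g [] = 0"
  shows "skew_derivs q v (conv f g) [] = 0"
  using assms
proof (induction v arbitrary: f g)
  case Nil
  then show ?case using Nil.prems[of "[]"] by simp
next
  case (Cons z v)
  have "skew_derivs q v (conv f (skew_deriv q z g)) [] = 0"
    using Cons.hyps Cons.prems[of "z # _"] by (intro Cons.IH) auto
  moreover have "skew_derivs q u (twist q z g) [] = 0" if "u \<in> lists X" for u
  proof -
    obtain a where "skew_derivs q u (twist q z g) = (\<lambda>w. a * twist q z (skew_derivs q u g) w)"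
      using skew_derivs_twist[of q u z g] by blast
    then show ?thesis using Cons.prems[OF that] by (simp add: twist_def)
  qed
  then have "skew_derivs q v (conv (skew_deriv q z f) (twist q z g)) [] = 0"
    by (intro Cons.IH) auto
  ultimately show ?case
    by (simp add: skew_deriv_conv skew_derivs_add)
qed

lemma ideal_skew_radical: "ideal (skew_radical X q) (tensor_algebra X)"
proof -
  interpret T: ring "tensor_algebra X"
    by (rule ring_tensor_algebra)
  show ?thesis
  proof (rule idealI)
    show "subgroup (skew_radical X q) (add_monoid (tensor_algebra X))"
    proof (rule T.add.subgroupI)
      show "skew_radical X q \<subseteq> carrier (tensor_algebra X)"
        by (auto simp: skew_radical_def)
      show "skew_radical X q \<noteq> {}"
        using T.zero_closed by (auto simp: skew_radical_def)
    next
      fix f assume f: "f \<in> skew_radical X q"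
      then have "f \<in> carrier (tensor_algebra X)"
        by (simp add: skew_radical_def)
      then have "\<ominus>\<^bsub>tensor_algebra X\<^esub> f = (\<lambda>w. -1 * f w)"
        using tensor_scale_closed[of f X "-1"] by (intro T.minus_equality) auto
      then show "\<ominus>\<^bsub>tensor_algebra X\<^esub> f \<in> skew_radical X q"
        using f skew_derivs_scale[of q _ "-1" f] tensor_scale_closed[of f X "-1"] by (auto simp: skew_radical_def)
    next
      fix f g assume "f \<in> skew_radical X q" "g \<in> skew_radical X q"
      then show "f \<oplus>\<^bsub>tensor_algebra X\<^esub> g \<in> skew_radical X q"
        by (simp add: skew_radical_def tensor_add_closed skew_derivs_add)
    qed
  qed (auto simp: skew_radical_def tensor_conv_closed ring_tensor_algebra skew_derivs_conv_Nil_left[of _ X]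
      skew_derivs_conv_Nil_right[of _ X])
qed

section \<open>The Nichols ideal\<close>

definition word :: "'x list \<Rightarrow> 'x list \<Rightarrow> complex" where
  "word w = (\<lambda>u. if u = w then 1 else 0)"

text \<open>Half of the counit law. It identifies the part of \<Delta>(w) to which a new right-hand
  letter can be attached.\<close>

lemma comult_word_Nil_right: "comult_word X c w (u, []) = word w u"
  by (induction w arbitrary: u) (auto simp: word_def split: list.splits)

lemma braid_past_diagonal:
  assumes "finite X" "diagonal_braiding X c q" "w \<in> lists X" "x \<in> X"
  shows "braid_past X c w x (u, z) = (if u = w \<and> z = x then weight q x w else 0)"
  using assms(3)
proof (induction w arbitrary: u)
  case (Cons y w)
  have "(\<Sum>x'\<in>X. c x y (y', x') * braid_past X c w x' (u', z)) =
      (if y' = y then q x y * braid_past X c w x (u', z) else 0)" for y' u'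
  proof -
    have "(\<Sum>x'\<in>X. c x y (y', x') * braid_past X c w x' (u', z)) =
        (\<Sum>x'\<in>X. if x = x' then (if y' = y then q x y * braid_past X c w x (u', z) else 0) else 0)"
      using assms(2,4) Cons.hyps by (intro sum.cong) (auto simp: diagonal_braiding_def)
    then show ?thesis
      using assms(1,4) by simp
  qed
  then show ?case
    using Cons.IH by (auto split: list.splits)
qed auto

lemma skew_deriv_word_Cons:
  "skew_deriv q z (word (x # w)) (y # u) =
     (if z = x \<and> w = y # u then weight q z w else 0) + (if y = x then skew_deriv q z (word w) u else 0)"
proof -
  have "(\<lambda>v. word (x # w) (y # v)) = (\<lambda>v. (if y = x then 1 else 0) * word w v)"
    by (auto simp: word_def)
  then show ?thesis
    by (simp add: skew_deriv_Cons skew_deriv_scale) (auto simp: word_def)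
qed

text \<open>With right word \<open>[z]\<close>, the second summand of \<Delta>(x w) uses only w
  \<otimes> 1. Braiding \<open>x\<close> past \<open>w\<close> gives the weight, which is the term
  of \<open>skew_deriv\<close> that deletes the first letter.\<close>

lemma comult_word_letter:
  assumes "finite X" "diagonal_braiding X c q" "w \<in> lists X"
  shows "comult_word X c w (u, [z]) = skew_deriv q z (word w) u"
  using assms(3)
proof (induction w arbitrary: u)
  case Nil
  then show ?case
    by (cases u) (simp_all add: skew_deriv_Nil skew_deriv_Cons word_def)
next
  case (Cons x w)
  have fin: "finite {a \<in> lists X. length a = length u}"
    using finite_lists_length_eq[OF assms(1), of "length u"] by (simp add: lists_eq_set)
  have "(\<Sum>a\<in>{a \<in> lists X. length a = length u}.
           comult_word X c w (a, []) * braid_past X c a x (u, z)) =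
        (\<Sum>a\<in>{a \<in> lists X. length a = length u}.
           if w = a then (if u = w \<and> z = x then weight q x w else 0) else 0)"
    using Cons.hyps braid_past_diagonal[OF assms(1,2)]
    by (intro sum.cong) (auto simp: comult_word_Nil_right word_def)
  also have "\<dots> = (if u = w \<and> z = x then weight q x w else 0)"
    using fin Cons.hyps by auto
  finally show ?case
    using Cons by (cases u) (auto simp: skew_deriv_Nil skew_deriv_word_Cons, auto simp: word_def)
qed

lemma comult_letter:
  assumes "finite X" "diagonal_braiding X c q" "f \<in> carrier (tensor_algebra X)"
  shows "comult X c f (u, [z]) = skew_deriv q z f u"
proof -
  have fin: "finite {w. f w \<noteq> 0}"
    using assms(3) by (simp add: carrier_tensor_algebra)
  have "f = (\<lambda>v. \<Sum>w | f w \<noteq> 0. f w * word w v)"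
  proof
    fix v
    have "(\<Sum>w | f w \<noteq> 0. f w * word w v) = (\<Sum>w | f w \<noteq> 0. if v = w then f v else 0)"
      by (intro sum.cong) (auto simp: word_def)
    then show "f v = (\<Sum>w | f w \<noteq> 0. f w * word w v)"
      using fin by simp
  qed
  then have "skew_deriv q z f u = (\<Sum>w | f w \<noteq> 0. f w * skew_deriv q z (word w) u)"
    using skew_deriv_sum[of q z "\<lambda>w v. f w * word w v" "{w. f w \<noteq> 0}"] by (simp add: skew_deriv_scale)
  also have "\<dots> = comult X c f (u, [z])"
    using assms comult_word_letter[OF assms(1,2)] unfolding comult_def
    by (intro sum.cong) (auto simp: carrier_tensor_algebra simp del: in_lists_conv_set)
  finally show ?thesis ..
qed

text \<open>Write \<Delta>(f) as a sum of a_i \<otimes> b_i and read off the coefficient of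
  \<open>z\<close> on the right. If b_i lies in \<open>I\<close>, it has no part of degree one and
  contributes nothing; otherwise a_i lies in \<open>I\<close>.\<close>

lemma relation_ideal_skew_deriv_closed:
  assumes "finite X" "diagonal_braiding X c q" "I \<in> nichols_relation_ideals X c" "f \<in> I"
  shows "skew_deriv q z f \<in> I"
proof -
  interpret ideal I "tensor_algebra X"
    using assms(3) by (simp add: nichols_relation_ideals_def)
  have low: "h w = 0" if "h \<in> I" "length w < 2" for h w
    using assms(3) that by (simp add: nichols_relation_ideals_def)
  have "comult X c f \<in> coideal_space X I"
    using assms(3,4) by (auto simp: nichols_relation_ideals_def)
  then obtain n :: nat and a b where ab: "comult X c f = (\<lambda>(u, v). \<Sum>i<n. a i u * b i v)"
    "\<And>i. i < n \<Longrightarrow> a i \<in> I \<or> b i \<in> I"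
    unfolding coideal_space_def by blast
  have "skew_deriv q z f = (\<lambda>u. \<Sum>i<n. b i [z] * a i u)"
    using comult_letter[OF assms(1,2) a_Hcarr[OF assms(4)], of _ z] ab(1)
    by (simp add: fun_eq_iff mult.commute)
  moreover have "(\<lambda>u. \<Sum>i<m. b i [z] * a i u) \<in> I" if "m \<le> n" for m
    using that
  proof (induction m)
    case 0
    then show ?case using additive_subgroup.zero_closed[OF is_additive_subgroup] by simp
  next
    case (Suc m)
    \<comment> \<open>\<open>I\<close> is given as a ring ideal; scalar multiples arise as products
      with elements of degree zero.\<close>
    have "(\<lambda>u. b m [z] * a m u) \<in> I"
    proof (cases "a m \<in> I")
      case True
      then show ?thesis
        using I_l_closed[OF _ tensor_scalar_closed, of "a m" "b m [z]"]
        by (simp add: conv_tensor_scalar_left)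
    next
      case False
      then have "b m [z] = 0"
        using ab(2)[of m] low Suc.prems by auto
      then show ?thesis
        using additive_subgroup.zero_closed[OF is_additive_subgroup] by simp
    qed
    moreover have "(\<lambda>u. \<Sum>i<m. b i [z] * a i u) \<in> I"
      using Suc by simp
    ultimately show ?case
      using additive_subgroup.a_closed[OF is_additive_subgroup,
          of "\<lambda>u. \<Sum>i<m. b i [z] * a i u" "\<lambda>u. b m [z] * a m u"] by simp
  qed
  ultimately show ?thesis
    by simp
qed

text \<open>Every relation ideal is stable under skew derivations and free of constant terms, so it
  lies in the radical. The radical is itself an ideal, hence contains what they generate.\<close>

lemma nichols_ideal_subset_skew_radical:
  assumes "finite X" "diagonal_braiding X c q"
  shows "nichols_ideal X c \<subseteq> skew_radical X q"
proof -
  interpret T: ring "tensor_algebra X"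
    by (rule ring_tensor_algebra)
  have "f \<in> skew_radical X q" if I: "I \<in> nichols_relation_ideals X c" and f: "f \<in> I" for I f
  proof -
    have "ideal I (tensor_algebra X)"
      using I by (simp add: nichols_relation_ideals_def)
    then have "f \<in> carrier (tensor_algebra X)"
      using f by (rule ideal.Icarr)
    moreover have "skew_derivs q v f \<in> I" for v
      using f by (induction v arbitrary: f) (auto intro: relation_ideal_skew_deriv_closed[OF assms I])
    then have "skew_derivs q v f [] = 0" for v
      using I by (auto simp: nichols_relation_ideals_def)
    ultimately show ?thesis
      by (simp add: skew_radical_def)
  qed
  then show ?thesis
    unfolding nichols_ideal_def by (intro T.genideal_minimal ideal_skew_radical) blast
qed

section \<open>From the Nichols ideal to the dimension of the quotient\<close>

lemma ideal_nichols_ideal: "ideal (nichols_ideal X c) (tensor_algebra X)"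
  unfolding nichols_ideal_def
  by (intro ring.genideal_ideal ring_tensor_algebra)
    (auto simp: nichols_relation_ideals_def dest: ideal.Icarr)

text \<open>
  A finite-dimensional quotient has representatives of bounded degree, and these are killed by
  long sequences of skew derivations.
\<close>

lemma nichols_infinite_dimI:
  assumes "finite X" "diagonal_braiding X c q"
    and unbounded: "\<And>d. \<exists>v\<in>lists X. \<exists>f\<in>carrier (tensor_algebra X). 
      length v > d \<and> skew_derivs q v f [] \<noteq> 0"
  shows "nichols_infinite_dim X c"
proof -
  define T I where "T = tensor_algebra X" and "I = nichols_ideal X c"
  interpret ideal I T
    unfolding I_def T_def by (rule ideal_nichols_ideal)
  interpret Q: ring "T Quot I"
    by (rule quotient_is_ring)
  interpret h: ring_hom_ring T "T Quot I" "(+>\<^bsub>T\<^esub>) I"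
    by (rule rcos_ring_hom_ring)
  define K where "K = range (\<lambda>a. I +>\<^bsub>T\<^esub> tensor_scalar a)"
  have cosets: "carrier (T Quot I) = (\<lambda>f. I +>\<^bsub>T\<^esub> f) ` carrier T"
    unfolding FactRing_def A_RCOSETS_def' by (simp add: image_def) blast
  \<comment> \<open>Each step of the inductive \<open>dimension\<close> adjoins multiples of one
    coset, whose representative has finite support, so the bound grows to a maximum. The equation
    \<open>K' = K\<close> keeps the scalars fixed through the rule induction.\<close>
  have bounded: "\<exists>d. \<forall>C\<in>E. \<exists>f\<in>carrier T. C = I +>\<^bsub>T\<^esub> f \<and> (\<forall>w. length w > d \<longrightarrow> f w = 0)"
    if "Q.dimension n K' E" "K' = K" for n K' E
    using that
  proof induction
    case (zero_dim K)
    show ?case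
      using h.hom_zero by (intro exI[of _ 0]) (auto simp: T_def tensor_zero_closed intro!: bexI[of _ "\<lambda>w. 0"])
  next
    case (Suc_dim v E n K')
    then obtain d where d: "\<And>C. C \<in> E \<Longrightarrow>
        \<exists>f\<in>carrier T. C = I +>\<^bsub>T\<^esub> f \<and> (\<forall>w. length w > d \<longrightarrow> f w = 0)"
      by blast
    obtain f where f: "f \<in> carrier T" "v = I +>\<^bsub>T\<^esub> f"
      using Suc_dim.hyps(1) cosets by auto
    have "finite {w. f w \<noteq> 0}"
      using f(1) by (simp add: T_def carrier_tensor_algebra)
    then obtain e where e: "\<And>w. length w > e \<Longrightarrow> f w = 0"
      using finite_maxlen[of "{w. f w \<noteq> 0}"] by (metis less_asym' mem_Collect_eq)
    show ?case
    proof (intro exI[of _ "max d e"] ballI)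
      fix C assume C: "C \<in> Q.line_extension K' v E"
      obtain a C' where C': "C' \<in> E" "C = (I +>\<^bsub>T\<^esub> tensor_scalar a) \<otimes>\<^bsub>T Quot I\<^esub> v \<oplus>\<^bsub>T Quot I\<^esub> C'"
        using C Suc_dim.prems unfolding Q.line_extension_mem_iff K_def by blast
      obtain g where g: "g \<in> carrier T" "C' = I +>\<^bsub>T\<^esub> g" "\<And>w. length w > d \<Longrightarrow> g w = 0"
        using d[OF C'(1)] by blast
      have "C = I +>\<^bsub>T\<^esub> (tensor_scalar a \<otimes>\<^bsub>T\<^esub> f \<oplus>\<^bsub>T\<^esub> g)"
        using f g tensor_scalar_closed[of a X] unfolding C'(2) by (simp add: T_def[symmetric] del: tensor_algebra_simps)
      also have "tensor_scalar a \<otimes>\<^bsub>T\<^esub> f \<oplus>\<^bsub>T\<^esub> g = (\<lambda>w. a * f w + g w)"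
        by (simp add: T_def conv_tensor_scalar_left)
      finally have "C = I +>\<^bsub>T\<^esub> (\<lambda>w. a * f w + g w)" .
      then show "\<exists>k\<in>carrier T. C = I +>\<^bsub>T\<^esub> k \<and> (\<forall>w. length w > max d e \<longrightarrow> k w = 0)"
        using f(1) g(1,3) e by (intro bexI[of _ "\<lambda>w. a * f w + g w"])
          (auto simp: T_def intro!: tensor_add_closed tensor_scale_closed)
    qed
  qed
  have "\<not> Q.dimension n K (carrier (T Quot I))" for n
  proof
    assume "Q.dimension n K (carrier (T Quot I))"
    from bounded[OF this refl] obtain d where d: "\<forall>C\<in>carrier (T Quot I).
        \<exists>g\<in>carrier T. C = I +>\<^bsub>T\<^esub> g \<and> (\<forall>w. length w > d \<longrightarrow> g w = 0)"
      by (rule exE)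
    obtain v f where v: "v \<in> lists X" "length v > d" "f \<in> carrier T" "skew_derivs q v f [] \<noteq> 0"
      using unbounded[of d] by (auto simp: T_def)
    obtain g where g: "g \<in> carrier T" "I +>\<^bsub>T\<^esub> f = I +>\<^bsub>T\<^esub> g" "\<And>w. length w > d \<Longrightarrow> g w = 0"
      using bspec[OF d h.hom_closed[OF v(3)]] by (elim bexE conjE) simp
    \<comment> \<open>\<open>f\<close> is the sum of an element \<open>i\<close> of the ideal and
      \<open>g\<close>. The functional given by \<open>v\<close> kills \<open>i\<close> by the
      radical and \<open>g\<close> for reasons of degree, but not \<open>f\<close>.\<close>
    have "f \<in> I +>\<^bsub>T\<^esub> g"
      using a_rcos_self[OF v(3)] g(2) by simp
    then obtain i where i: "i \<in> I" "f = (\<lambda>w. i w + g w)"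
      by (auto simp: a_r_coset_def' T_def)
    have "i \<in> skew_radical X q"
      using i(1) nichols_ideal_subset_skew_radical[OF assms(1,2)] by (auto simp: I_def)
    then have "skew_derivs q v i [] = 0"
      using v(1) by (simp add: skew_radical_def)
    moreover have "skew_derivs q v g [] = 0"
      using g(3) v(2) by (intro skew_derivs_local) simp
    ultimately show False
      using v(4) i(2) by (simp add: skew_derivs_add)
  qed
  then show ?thesis
    unfolding nichols_infinite_dim_def nichols_algebra_def nichols_scalars_def
    by (fold T_def I_def, fold K_def) (simp add: Q.finite_dimension_def)
qed

section \<open>Elements with nonvanishing iterated skew derivations\<close>

text \<open>The new factor stands on the right, so that the Leibniz rule twists \<open>z\<close> and
  not the power.\<close>

primrec conv_power :: "('x list \<Rightarrow> complex) \<Rightarrow> nat \<Rightarrow> 'x list \<Rightarrow> complex" where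
  "conv_power z 0 = tensor_scalar 1"
| "conv_power z (Suc n) = conv (conv_power z n) z"

lemma conv_power_closed:
  "z \<in> carrier (tensor_algebra X) \<Longrightarrow> conv_power z n \<in> carrier (tensor_algebra X)"
  by (induction n) (simp_all add: tensor_scalar_closed tensor_conv_closed)

text \<open>Let D = \<open>skew_derivs q v\<close>. Since D(1) = 0, the rule \<open>leibniz\<close>
  gives D(z^n) = n \<nu> z^(n-1), and n applications of D turn z^n into the nonzero scalar n!
  \<nu>^n.\<close>

lemma nichols_infinite_dim_powers:
  assumes "finite X" "diagonal_braiding X c q" "v \<in> lists X" "v \<noteq> []"
    and z: "z \<in> carrier (tensor_algebra X)" and "\<nu> \<noteq> 0"
    and leibniz: "\<And>n. skew_derivs q v (conv_power z (Suc n)) =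
      (\<lambda>w. \<nu> * conv_power z n w + conv (skew_derivs q v (conv_power z n)) z w)"
  shows "nichols_infinite_dim X c"
proof (rule nichols_infinite_dimI[OF assms(1,2)])
  fix d
  have one: "skew_derivs q v (conv_power z 0) = (\<lambda>w. 0)"
    using assms(4) by (cases v) simp_all
  have step: "skew_derivs q v (conv_power z (Suc n)) = (\<lambda>w. (of_nat (Suc n) * \<nu>) * conv_power z n w)" for n
  proof (induction n)
    case 0
    show ?case by (subst leibniz) (simp only: one, simp)
  next
    case (Suc n)
    show ?case
      by (subst leibniz, subst Suc, subst conv_scale_left)
        (simp only: conv_power.simps(2)[symmetric], simp add: algebra_simps del: conv_power.simps)
  qed
  have "skew_derivs q (concat (replicate n v)) (conv_power z n) = tensor_scalar (fact n * \<nu> ^ n)" for n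
  proof (induction n)
    case (Suc n)
    have "skew_derivs q (concat (replicate (Suc n) v)) (conv_power z (Suc n)) =
        (\<lambda>w. (of_nat (Suc n) * \<nu>) * tensor_scalar (fact n * \<nu> ^ n) w)"
      by (simp add: skew_derivs_append step skew_derivs_scale Suc del: conv_power.simps of_nat_Suc)
    then show ?case
      by (simp add: tensor_scalar_def fun_eq_iff algebra_simps)
  qed simp
  moreover have "length (concat (replicate (Suc d) v)) > d"
  proof -
    have "length (concat (replicate (Suc d) v)) = Suc d * length v"
      by (simp add: length_concat sum_list_replicate)
    also have "d < Suc d * length v"
      using assms(4) by (cases v) simp_all
    finally show ?thesis .
  qed
  moreover have "concat (replicate (Suc d) v) \<in> lists X"
    using assms(3) by auto
  moreover have "fact (Suc d) * \<nu> ^ Suc d \<noteq> 0"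
    using assms(6) by (simp del: fact_Suc)
  ultimately show "\<exists>v\<in>lists X. \<exists>f\<in>carrier (tensor_algebra X). length v > d \<and> skew_derivs q v f [] \<noteq> 0"
    using conv_power_closed[OF z, of "Suc d"] assms(6)
    by (intro bexI[of _ "concat (replicate (Suc d) v)"] bexI[of _ "conv_power z (Suc d)"])
      (auto simp: tensor_scalar_def simp del: fact_Suc power_Suc concat.simps replicate.simps conv_power.simps)
qed

abbreviation letter :: "'x \<Rightarrow> 'x list \<Rightarrow> complex" where
  "letter x \<equiv> word [x]"

lemma word_closed: "w \<in> lists X \<Longrightarrow> word w \<in> carrier (tensor_algebra X)"
  by (auto simp: carrier_tensor_algebra word_def)

lemma skew_deriv_letter: "skew_deriv q z (letter x) = tensor_scalar (if z = x then 1 else 0)"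
proof
  show "skew_deriv q z (letter x) w = tensor_scalar (if z = x then 1 else 0) w" for w
  proof (cases w)
    case (Cons a u)
    have "(\<lambda>v. letter x (a # v)) = tensor_scalar (if a = x then 1 else 0)"
      by (auto simp: word_def tensor_scalar_def)
    then show ?thesis
      by (simp add: Cons skew_deriv_Cons) (simp add: word_def tensor_scalar_def)
  qed (simp add: skew_deriv_Nil word_def tensor_scalar_def)
qed

lemma twist_letter: "twist q z (letter x) = (\<lambda>w. q z x * letter x w)"
  by (auto simp: twist_def word_def)

lemma nichols_infinite_dim_point:
  assumes "finite X" "diagonal_braiding X c q" "x \<in> X" "q x x = 1"
  shows "nichols_infinite_dim X c"
proof (rule nichols_infinite_dim_powers[OF assms(1,2), of "[x]" "letter x" 1])
  show "skew_derivs q [x] (conv_power (letter x) (Suc n)) =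
      (\<lambda>w. 1 * conv_power (letter x) n w + conv (skew_derivs q [x] (conv_power (letter x) n)) (letter x) w)" for n
    using assms(4) by (simp add: skew_deriv_conv skew_deriv_letter twist_letter conv_tensor_scalar_right)
qed (use assms(3) in \<open>auto simp: word_closed\<close>)

lemma skew_deriv_diff_scale:
  "skew_deriv q z (\<lambda>w. f w - a * g w) = (\<lambda>w. skew_deriv q z f w - a * skew_deriv q z g w)"
  using skew_deriv_add[of q z f "\<lambda>w. - a * g w"] skew_deriv_scale[of q z "- a" g] by (simp add: fun_eq_iff)

lemma twist_diff_scale: "twist q z (\<lambda>w. f w - a * g w) = (\<lambda>w. twist q z f w - a * twist q z g w)"
  by (simp add: twist_def algebra_simps)

lemma conv_diff_scale:
  "conv (\<lambda>w. f w - a * g w) h = (\<lambda>w. conv f h w - a * conv g h w)"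
  "conv h (\<lambda>w. f w - a * g w) = (\<lambda>w. conv h f w - a * conv h g w)"
  using conv_add_left[of f "\<lambda>w. - a * g w" h] conv_add_right[of h f "\<lambda>w. - a * g w"]
    conv_scale_left[of "- a" g h] conv_scale_right[of h "- a" g]
  by (simp_all add: fun_eq_iff)

lemma diff_scale_closed:
  assumes "f \<in> carrier (tensor_algebra X)" "g \<in> carrier (tensor_algebra X)"
  shows "(\<lambda>w. f w - a * g w) \<in> carrier (tensor_algebra X)"
  using tensor_add_closed[OF assms(1) tensor_scale_closed[OF assms(2)], of "- a"] by simp

text \<open>
  The iterated braided commutator \<open>z = [x, [y, t]]\<close> is killed by the skew derivations
  \<open>\<partial>\<^sub>x\<close> and \<open>\<partial>\<^sub>y\<close>, and it braids trivially with the three letters.  Hence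
  \<open>\<partial>\<^sub>y \<partial>\<^sub>x \<partial>\<^sub>t\<close> acts on the powers of \<open>z\<close> as an ordinary derivation.
\<close>

lemma nichols_infinite_dim_triangle:
  assumes "finite X" "diagonal_braiding X c q" "{x, y, t} \<subseteq> X" "distinct [x, y, t]"
    and triv: "\<And>i. i \<in> {x, y, t} \<Longrightarrow> q i x * q i y * q i t = 1"
    and "q x t * q t x \<noteq> 1" "q y t * q t y \<noteq> 1"
  shows "nichols_infinite_dim X c"
proof -
  \<comment> \<open>The coefficient makes the two contributions to the \<open>y\<close>-derivative
    cancel; the \<open>t\<close>-derivative keeps the factor \<open>1 - q y t * q t y\<close>. The
    coefficient in \<open>z\<close> does the same for \<open>x\<close>.\<close>
  define u where "u = (\<lambda>w. conv (letter y) (letter t) w - q y t * conv (letter t) (letter y) w)"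
  define z where "z = (\<lambda>w. conv (letter x) u w - (q x y * q x t) * conv u (letter x) w)"
  have neq: "x \<noteq> y" "x \<noteq> t" "y \<noteq> t" "y \<noteq> x" "t \<noteq> x" "t \<noteq> y"
    using assms(4) by auto
  note simps = skew_deriv_diff_scale skew_deriv_scale conv_diff_scale skew_deriv_conv
    skew_deriv_letter twist_diff_scale twist_conv twist_letter
    conv_scale_left conv_scale_right conv_tensor_scalar_left conv_tensor_scalar_right neq
  have u: "skew_deriv q x u = (\<lambda>w. 0)" "skew_deriv q y u = (\<lambda>w. 0)"
    "skew_deriv q t u = (\<lambda>w. (1 - q y t * q t y) * letter y w)"
    "\<And>i. twist q i u = (\<lambda>w. (q i y * q i t) * u w)"
    by (simp_all only: u_def simps if_False if_True simp_thms) (simp_all add: fun_eq_iff algebra_simps)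
  have z: "skew_deriv q x z = (\<lambda>w. 0)" "skew_deriv q y z = (\<lambda>w. 0)"
    "skew_deriv q t z = (\<lambda>w. (1 - q y t * q t y) *
       (conv (letter x) (letter y) w - (q x y * q x t * q t x) * conv (letter y) (letter x) w))"
    by (simp_all only: z_def u simps if_False if_True simp_thms) (simp_all add: fun_eq_iff algebra_simps)
  \<comment> \<open>Every monomial of \<open>z\<close> contains each of the three letters
    once.\<close>
  have twist_z: "twist q i z = z" if "i \<in> {x, y, t}" for i
  proof -
    have "twist q i z = (\<lambda>w. (q i x * q i y * q i t) * z w)"
      by (simp_all only: z_def u simps) (simp_all add: fun_eq_iff algebra_simps)
    then show ?thesis using triv[OF that] by simp
  qed
  define \<nu> where "\<nu> = (1 - q y t * q t y) * (q x y * (1 - q x t * q t x))"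
  have xz: "skew_deriv q x (skew_deriv q t z) = (\<lambda>w. \<nu> * letter y w)"
    by (simp_all only: z simps if_False if_True simp_thms)
      (simp_all add: \<nu>_def fun_eq_iff tensor_scalar_def algebra_simps)
  have yxz: "skew_deriv q y (skew_deriv q x (skew_deriv q t z)) = tensor_scalar \<nu>"
    by (simp add: xz skew_deriv_scale skew_deriv_letter) (simp add: tensor_scalar_def fun_eq_iff)
  have kill: "skew_deriv q x (conv_power z n) = (\<lambda>w. 0)" "skew_deriv q y (conv_power z n) = (\<lambda>w. 0)" for n
    by (induction n) (simp_all add: skew_deriv_conv z)
  show ?thesis
  proof (rule nichols_infinite_dim_powers[OF assms(1,2), of "[t, x, y]" z \<nu>])
    \<comment> \<open>The list is applied from its head. Both \<open>z\<close> and its powers are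
      killed by the derivations at \<open>x\<close> and \<open>y\<close>, so these must hit the
      factor that the derivation at \<open>t\<close> has hit; all mixed terms vanish.\<close>
    show "skew_derivs q [t, x, y] (conv_power z (Suc n)) =
        (\<lambda>w. \<nu> * conv_power z n w + conv (skew_derivs q [t, x, y] (conv_power z n)) z w)" for n
      by (simp add: skew_deriv_conv skew_deriv_add kill twist_z z(1,2) yxz conv_tensor_scalar_right)
    \<comment> \<open>The remaining factor \<open>q x y\<close> is nonzero because it divides the
      product 1 in \<open>triv\<close>.\<close>
    show "\<nu> \<noteq> 0"
      using triv[of x] assms(6,7) by (auto simp: \<nu>_def)
    show "z \<in> carrier (tensor_algebra X)"
      unfolding z_def u_def using assms(3)
      by (intro diff_scale_closed tensor_conv_closed word_closed) auto
  qed (use assms(3) in auto)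
qed

section \<open>Yetter-Drinfeld modules with abelian support\<close>

lemma mat_minus_one_vector: "mat (- 1) *v v = - (v :: complex ^ 'n)"
proof -
  have "(mat (- 1) :: complex ^ 'n ^ 'n) = - mat 1"
    by (simp add: mat_def vec_eq_iff)
  then show ?thesis
    by (simp add: vec_eq_iff matrix_vector_mult_def sum_negf mat_def if_distrib
        if_distribR cong: if_cong)
qed

lemma mat_mult_mat: "(mat x :: complex ^ 'n ^ 'n) ** mat y = mat (x * y)"
proof -
  have "(\<Sum>k\<in>UNIV. (if i = k then x else 0) * (if k = j then y else 0)) =
      (\<Sum>k\<in>UNIV. if i = k then (if i = j then x * y else 0) else 0)" for i j :: 'n
    by (intro sum.cong) auto
  then show ?thesis
    by (simp add: matrix_matrix_mult_def mat_def vec_eq_iff)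
qed

text \<open>The fixed vectors of \<open>\<rho> h\<close> form a subrepresentation.\<close>

lemma involutive_irreducible_rep:
  assumes "group G" "subgroup H G" "irreducible_rep G H \<rho>"
    and inv: "\<And>h. h \<in> H \<Longrightarrow> h \<otimes>\<^bsub>G\<^esub> h = \<one>\<^bsub>G\<^esub>"
    and h: "h \<in> H"
  shows "\<rho> h = mat 1 \<or> \<rho> h = mat (- 1)"
proof -
  interpret group G by fact
  interpret H: subgroup H G by fact
  have mult: "\<rho> (x \<otimes>\<^bsub>G\<^esub> y) = \<rho> x ** \<rho> y" if "x \<in> H" "y \<in> H" for x y
    using assms(3) that by (simp add: irreducible_rep_def linear_rep_def)
  have comm: "x \<otimes>\<^bsub>G\<^esub> y = y \<otimes>\<^bsub>G\<^esub> x" if "x \<in> H" "y \<in> H" for x y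
  proof -
    have "inv\<^bsub>G\<^esub> z = z" if "z \<in> H" for z
      using inv that by (simp add: inv_equality)
    then show ?thesis
      using that inv_mult_group[of x y] by (metis H.m_closed H.mem_carrier)
  qed
  \<comment> \<open>\<open>linear_rep\<close> asks for invertibility and multiplicativity; the unit
    goes to an invertible idempotent.\<close>
  have one: "\<rho> \<one>\<^bsub>G\<^esub> = mat 1"
  proof -
    obtain B where "\<rho> \<one>\<^bsub>G\<^esub> ** B = mat 1"
      using assms(3) H.one_closed unfolding irreducible_rep_def linear_rep_def invertible_def by blast
    moreover have "\<rho> \<one>\<^bsub>G\<^esub> ** \<rho> \<one>\<^bsub>G\<^esub> = \<rho> \<one>\<^bsub>G\<^esub>"
      using mult[of "\<one>\<^bsub>G\<^esub>" "\<one>\<^bsub>G\<^esub>"] by simp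
    ultimately show ?thesis
      by (metis matrix_mul_assoc matrix_mul_rid)
  qed
  have sq: "\<rho> h *v (\<rho> h *v v) = v" for v
    by (simp add: matrix_vector_mul_assoc mult[OF h h, symmetric] inv[OF h] one)
  let ?U = "{v. \<rho> h *v v = v}"
  have "vec.subspace ?U"
    by (auto simp: vec.subspace_def matrix_vector_right_distrib vector_scalar_commute)
  moreover have "\<rho> k *v v \<in> ?U" if "k \<in> H" "v \<in> ?U" for k v
  proof -
    have "\<rho> h *v (\<rho> k *v v) = \<rho> k *v (\<rho> h *v v)"
      using comm[OF h that(1)] mult h that(1) by (metis matrix_vector_mul_assoc)
    then show ?thesis using that(2) by simp
  qed
  ultimately consider "?U = {0}" | "?U = UNIV"
    using assms(3) unfolding irreducible_rep_def by blast
  then show ?thesis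
  proof cases
    case 1
    \<comment> \<open>Symmetrization yields a fixed vector, as \<open>\<rho> h\<close> squares to
      the identity. If only 0 is fixed, this forces \<open>\<rho> h\<close> to be -1.\<close>
    have "v + \<rho> h *v v \<in> ?U" for v
      by (simp add: matrix_vector_right_distrib sq add.commute)
    then have "v + \<rho> h *v v = 0" for v
      using 1 by blast
    then have "\<rho> h *v v = mat (- 1) *v v" for v
      unfolding mat_minus_one_vector by (simp add: add_eq_0_iff)
    then show ?thesis
      by (simp add: matrix_eq)
  next
    case 2
    then have "\<rho> h *v v = v" for v by blast
    then show ?thesis by (simp add: matrix_eq)
  qed
qed

definition yd_matrix :: "('g, 'm) monoid_scheme \<Rightarrow> ('g \<Rightarrow> 'g) \<Rightarrow>
    ('g \<Rightarrow> complex ^ 'n ^ 'n) \<Rightarrow> 'g \<times> 'n \<Rightarrow> 'g \<times> 'n \<Rightarrow> complex" where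
  "yd_matrix G g \<rho> x y =
     \<rho> (inv\<^bsub>G\<^esub> (g (fst y)) \<otimes>\<^bsub>G\<^esub> (fst x \<otimes>\<^bsub>G\<^esub> g (fst y))) $ snd y $ snd y"

lemma (in group) conj_sectionD:
  assumes "conj_section G s g" "s \<in> carrier G" "t \<in> conj_class G s"
  shows "g t \<in> carrier G" "g t \<otimes> s = t \<otimes> g t" "t \<in> carrier G"
proof -
  show t: "t \<in> carrier G"
    using assms by (auto simp: conj_class_def)
  show g: "g t \<in> carrier G"
    using assms by (simp add: conj_section_def)
  have "g t \<otimes> s \<otimes> inv (g t) = t"
    using assms by (simp add: conj_section_def)
  then show "g t \<otimes> s = t \<otimes> g t"
    using g assms(2) t by (metis inv_solve_right' m_closed)
qed

text \<open>An element \<open>t\<close> of the class commutes with \<open>v\<close>, so it preserves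
  the summand of degree \<open>v\<close>. There it acts through an element of the centralizer, which
  \<rho> sends to a scalar matrix.\<close>

lemma (in group) diagonal_yd_braiding:
  fixes \<rho> :: "'a \<Rightarrow> complex ^ 'n ^ 'n"
  assumes "conj_section G s g" "s \<in> carrier G"
    and comm: "\<And>t u. t \<in> conj_class G s \<Longrightarrow> u \<in> conj_class G s \<Longrightarrow> t \<otimes> u = u \<otimes> t"
    and scalar: "\<And>h. h \<in> centralizer G s \<Longrightarrow> \<exists>a. \<rho> h = mat a"
  shows "diagonal_braiding (yd_basis G s) (yd_braiding G s g \<rho>) (yd_matrix G g \<rho>)"
proof -
  have centralizer_iff: "inv (g u) \<otimes> (t \<otimes> g v) \<in> centralizer G s \<longleftrightarrow> u = v"
    if t: "t \<in> conj_class G s" and u: "u \<in> conj_class G s" and v: "v \<in> conj_class G s" for t u v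
  proof -
    note carr = conj_sectionD[OF assms(1,2) t] conj_sectionD[OF assms(1,2) u]
      conj_sectionD[OF assms(1,2) v] assms(2)
    define w where "w = t \<otimes> g v"
    have w: "w \<in> carrier G"
      using carr by (simp add: w_def)
    \<comment> \<open>Like \<open>g v\<close>, the element \<open>w\<close> conjugates
      \<open>s\<close> to \<open>v\<close>; it differs from \<open>g u\<close> by an element of the
      centralizer exactly if \<open>u = v\<close>.\<close>
    have "w \<otimes> s = v \<otimes> w"
      using carr comm[OF t v] by (metis m_assoc w_def)
    then have 1: "inv (g u) \<otimes> w \<otimes> s = inv (g u) \<otimes> (v \<otimes> w)"
      using carr w by (simp add: m_assoc)
    have "s \<otimes> inv (g u) = inv (g u) \<otimes> u"
      using carr by (metis inv_closed inv_solve_left inv_solve_right m_assoc m_closed)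
    then have 2: "s \<otimes> (inv (g u) \<otimes> w) = inv (g u) \<otimes> (u \<otimes> w)"
      using carr w by (simp add: m_assoc[symmetric])
    have "inv (g u) \<otimes> w \<otimes> s = s \<otimes> (inv (g u) \<otimes> w) \<longleftrightarrow> u = v"
      unfolding 1 2 using carr w by auto
    then show ?thesis
      using carr w by (simp add: centralizer_def w_def)
  qed
  show ?thesis
    unfolding diagonal_braiding_def
  proof (intro ballI allI)
    fix x y y' x' :: "'a \<times> 'n"
    assume xy: "x \<in> yd_basis G s" "y \<in> yd_basis G s"
    obtain t i v k u l where eq: "x = (t, i)" "y = (v, k)" "y' = (u, l)"
      by (metis surj_pair)
    have tv: "t \<in> conj_class G s" "v \<in> conj_class G s"
      using xy by (auto simp: yd_basis_def eq)
    obtain a where "\<rho> (inv (g v) \<otimes> (t \<otimes> g v)) = mat a"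
      using scalar centralizer_iff[OF tv(1,2,2)] by blast
    then show "yd_braiding G s g \<rho> x y (y', x') =
        (if y' = y \<and> x' = x then yd_matrix G g \<rho> x y else 0)"
      using tv centralizer_iff[OF tv(1) _ tv(2), of u]
      by (auto simp: yd_braiding_def yd_action_def yd_matrix_def eq Let_def mat_def)
  qed
qed

text \<open>Write \<open>g u\<close> as \<open>\<sigma> \<otimes> \<kappa>\<close>. Then
  \<open>\<kappa>\<close> centralizes \<open>s\<close>, and conjugation by it fixes
  \<open>\<tau>\<close> as the centralizer is commutative. Entries can thus be computed with any
  convenient conjugator, whatever the section \<open>g\<close>.\<close>

lemma (in group) yd_matrix_eq:
  assumes "conj_section G s g" "s \<in> carrier G"
    and comm: "\<And>h k. h \<in> centralizer G s \<Longrightarrow> k \<in> centralizer G s \<Longrightarrow> h \<otimes> k = k \<otimes> h"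
    and t: "t \<in> carrier G" and u: "u \<in> conj_class G s"
    and \<sigma>: "\<sigma> \<in> carrier G" "\<sigma> \<otimes> s = u \<otimes> \<sigma>"
    and \<tau>: "\<tau> \<in> centralizer G s" "t \<otimes> \<sigma> = \<sigma> \<otimes> \<tau>"
  shows "yd_matrix G g \<rho> (t, i) (u, k) = \<rho> \<tau> $ k $ k"
proof -
  note carr = conj_sectionD[OF assms(1,2) u] assms(2) t \<sigma>(1)
  have \<tau>': "\<tau> \<in> carrier G"
    using \<tau>(1) by (simp add: centralizer_def)
  define \<kappa> where "\<kappa> = inv \<sigma> \<otimes> g u"
  have \<kappa>: "\<kappa> \<in> carrier G" "g u = \<sigma> \<otimes> \<kappa>"
    using carr by (simp_all add: \<kappa>_def m_assoc[symmetric])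
  have "\<sigma> \<otimes> (\<kappa> \<otimes> s) = u \<otimes> \<sigma> \<otimes> \<kappa>"
    using carr \<kappa> by (metis m_assoc)
  also have "\<dots> = \<sigma> \<otimes> (s \<otimes> \<kappa>)"
    using carr \<kappa> \<sigma>(2) by (metis m_assoc)
  finally have "\<kappa> \<in> centralizer G s"
    using carr \<kappa>(1) by (simp add: centralizer_def)
  have "t \<otimes> g u = \<sigma> \<otimes> (\<tau> \<otimes> \<kappa>)"
    using carr \<kappa> \<tau>(2) \<tau>' by (metis m_assoc)
  also have "\<dots> = g u \<otimes> \<tau>"
    using carr \<kappa> \<tau>' comm[OF \<tau>(1) \<open>\<kappa> \<in> centralizer G s\<close>] by (metis m_assoc)
  finally have "inv (g u) \<otimes> (t \<otimes> g u) = \<tau>"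
    using carr \<tau>' by (simp add: m_assoc[symmetric])
  then show ?thesis
    by (simp add: yd_matrix_def)
qed

lemma (in group) subgroup_centralizer:
  assumes "s \<in> carrier G"
  shows "subgroup (centralizer G s) G"
proof (rule subgroupI)
  show "centralizer G s \<noteq> {}"
    using assms by (auto simp: centralizer_def)
  show "inv h \<in> centralizer G s" if "h \<in> centralizer G s" for h
    using that assms unfolding centralizer_def
    by simp (metis inv_closed inv_solve_left inv_solve_right m_assoc m_closed)
  show "h \<otimes> k \<in> centralizer G s" if "h \<in> centralizer G s" "k \<in> centralizer G s" for h k
    using that assms unfolding centralizer_def by simp (metis m_assoc)
qed (auto simp: centralizer_def)

section \<open>Double transpositions in the alternating group of degree four\<close>

text \<open>The two transpositions may share a point, so this also covers three-cycles.\<close>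

lemma double_transposition_in_alt_group:
  assumes "{a, b, c, d} \<subseteq> {1..n}" "a \<noteq> b" "c \<noteq> d"
  shows "Transposition.transpose a b \<circ> Transposition.transpose c d \<in> carrier (alt_group n)"
  using assms unfolding alt_group_carrier
  by (auto intro!: permutes_compose permutes_swap_id
      simp: evenperm_comp permutation_swap_id evenperm_swap)

text \<open>\<open>t1\<close> and \<open>t2\<close> are the other two double transpositions.
  \<open>\<sigma>\<close> is the three-cycle b, c, d; conjugation by it permutes \<open>s\<close>,
  \<open>t1\<close>, \<open>t2\<close> cyclically.\<close>

context
  fixes a b c d :: nat and s t1 t2 \<sigma> :: "nat \<Rightarrow> nat"
  assumes points: "{1..4} = {a, b, c, d}" and dist: "distinct [a, b, c, d]"
  defines "s \<equiv> Transposition.transpose a b \<circ> Transposition.transpose c d"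
    and "t1 \<equiv> Transposition.transpose a c \<circ> Transposition.transpose b d"
    and "t2 \<equiv> Transposition.transpose a d \<circ> Transposition.transpose b c"
    and "\<sigma> \<equiv> Transposition.transpose b c \<circ> Transposition.transpose c d"
begin

private lemma neq:
  "a \<noteq> b" "a \<noteq> c" "a \<noteq> d" "b \<noteq> c" "b \<noteq> d" "c \<noteq> d"
  "b \<noteq> a" "c \<noteq> a" "d \<noteq> a" "c \<noteq> b" "d \<noteq> b" "d \<noteq> c"
  using dist by auto

lemma klein_values:
  "s a = b" "s b = a" "s c = d" "s d = c"
  "t1 a = c" "t1 b = d" "t1 c = a" "t1 d = b"
  "t2 a = d" "t2 b = c" "t2 c = b" "t2 d = a"
  "\<sigma> a = a" "\<sigma> b = c" "\<sigma> c = d" "\<sigma> d = b"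
  by (simp_all add: s_def t1_def t2_def \<sigma>_def transpose_def neq)

lemma klein_outside:
  assumes "x \<notin> {a, b, c, d}"
  shows "s x = x" "t1 x = x" "t2 x = x" "\<sigma> x = x"
  using assms by (simp_all add: s_def t1_def t2_def \<sigma>_def transpose_def)

private lemma pointwise:
  assumes "f a = h a" "f b = h b" "f c = h c" "f d = h d" "\<And>x. x \<notin> {a, b, c, d} \<Longrightarrow> f x = h x"
  shows "f = (h :: nat \<Rightarrow> nat)"
proof
  show "f x = h x" for x
    using assms by (cases "x \<in> {a, b, c, d}") (elim insertE emptyE, simp_all)
qed

lemma klein_mult:
  "s \<circ> s = id" "t1 \<circ> t1 = id" "t2 \<circ> t2 = id"
  "s \<circ> t1 = t2" "t1 \<circ> s = t2" "s \<circ> t2 = t1" "t2 \<circ> s = t1" "t1 \<circ> t2 = s" "t2 \<circ> t1 = s"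
  by (rule pointwise; simp add: klein_values klein_outside)+

lemma klein_conj:
  "s \<circ> \<sigma> = \<sigma> \<circ> t2" "t1 \<circ> \<sigma> = \<sigma> \<circ> s" "t2 \<circ> \<sigma> = \<sigma> \<circ> t1"
  "s \<circ> (\<sigma> \<circ> \<sigma>) = (\<sigma> \<circ> \<sigma>) \<circ> t1" "t1 \<circ> (\<sigma> \<circ> \<sigma>) = (\<sigma> \<circ> \<sigma>) \<circ> t2" "t2 \<circ> (\<sigma> \<circ> \<sigma>) = (\<sigma> \<circ> \<sigma>) \<circ> s"
  by (rule pointwise; simp add: klein_values klein_outside)+

lemma klein_carrier:
  "s \<in> carrier (alt_group 4)" "t1 \<in> carrier (alt_group 4)" "t2 \<in> carrier (alt_group 4)"
  "\<sigma> \<in> carrier (alt_group 4)"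
  unfolding s_def t1_def t2_def \<sigma>_def
  by (rule double_transposition_in_alt_group, simp_all only: points, simp_all add: neq)+

text \<open>The Klein four-group is transitive on the points, so some \<open>v\<close> in it makes
  \<open>p = v \<circ> h\<close> fix \<open>a\<close>. Commuting with \<open>s\<close>,
  \<open>p\<close> also fixes \<open>b\<close>; it is then the identity or the transposition of
  \<open>c\<close> and \<open>d\<close>, and the latter is odd.\<close>

lemma centralizer_subset_klein: "centralizer (alt_group 4) s \<subseteq> {id, s, t1, t2}"
proof
  fix h assume "h \<in> centralizer (alt_group 4) s"
  then have h: "h \<in> carrier (alt_group 4)" "h \<circ> s = s \<circ> h"
    by (simp_all add: centralizer_def alt_group_mult)
  have "h a \<in> {a, b, c, d}"
    using h(1) points permutes_in_image[of h "{1..4}" a] by (auto simp: alt_group_carrier)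
  then obtain v where v: "v \<in> {id, s, t1, t2}" "v (h a) = a"
    using klein_values by fastforce
  have vv: "v \<circ> v = id" and vs: "v \<circ> s = s \<circ> v" and "v \<in> carrier (alt_group 4)"
    using v(1) klein_mult klein_carrier by (auto simp: alt_group_carrier permutes_id evenperm_id)
  define p where "p = v \<circ> h"
  have p: "p permutes {a, b, c, d}" "evenperm p"
    using h(1) \<open>v \<in> carrier (alt_group 4)\<close> alt_group_carrier'[of h 4] alt_group_carrier'[of v 4]
    by (simp_all only: p_def alt_group_carrier points permutes_compose evenperm_comp)
  have pa: "p a = a"
    using v(2) by (simp add: p_def)
  have "p \<circ> s = s \<circ> p"
    using h(2) vs by (metis comp_assoc p_def)
  then have "p (s x) = s (p x)" for x
    by (metis comp_apply)
  from this[of a] this[of c] have pb: "p b = b" and pd: "p d = s (p c)"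
    using klein_values pa by simp_all
  have "p c \<in> {a, b, c, d}" "p c \<noteq> p a" "p c \<noteq> p b"
    using p(1) neq permutes_in_image[OF p(1), of c] permutes_inj[OF p(1)] by (auto dest: injD)
  then consider "p c = c" | "p c = d"
    using pa pb by auto
  then have "p = id"
  proof cases
    case 1
    then have "p d = d"
      using pd klein_values by simp
    then show ?thesis
      using 1 pa pb permutes_not_in[OF p(1)] by (intro pointwise) simp_all
  next
    case 2
    then have "p d = c"
      using pd klein_values by simp
    then have "p = Transposition.transpose c d"
      using 2 pa pb permutes_not_in[OF p(1)] neq
      by (intro pointwise) (simp_all add: transpose_def)
    then show ?thesis
      using p(2) neq by (simp add: evenperm_swap)
  qed
  then have "h = v"
    using vv by (metis comp_assoc comp_id id_comp p_def)
  then show "h \<in> {id, s, t1, t2}"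
    using v(1) by simp
qed

text \<open>A conjugate of \<open>s\<close> is an involution moving all four points, hence
  determined by the image of \<open>a\<close>. Conversely, \<open>id\<close>,
  \<open>\<sigma>\<close> and \<open>\<sigma> \<circ> \<sigma>\<close> conjugate \<open>s\<close> to
  the three candidates within the alternating group.\<close>

lemma conj_class_klein: "conj_class (alt_group 4) s = {s, t1, t2}"
proof -
  interpret group "alt_group 4"
    by (rule alt_group_is_group)
  have mem: "x \<in> conj_class (alt_group 4) s"
    if "h \<in> carrier (alt_group 4)" "x \<in> carrier (alt_group 4)" "x \<circ> h = h \<circ> s" for h x
  proof -
    have "x = h \<otimes>\<^bsub>alt_group 4\<^esub> s \<otimes>\<^bsub>alt_group 4\<^esub> inv\<^bsub>alt_group 4\<^esub> h"
      using that klein_carrier(1) inv_solve_right[of x "h \<otimes>\<^bsub>alt_group 4\<^esub> s" h]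
        m_closed[OF that(1) klein_carrier(1)]
      by (simp add: alt_group_mult)
    then show ?thesis
      using that(1) by (auto simp: conj_class_def)
  qed
  have "x \<in> {s, t1, t2}" if "x \<in> conj_class (alt_group 4) s" for x
  proof -
    have "\<exists>h. x = h \<otimes>\<^bsub>alt_group 4\<^esub> s \<otimes>\<^bsub>alt_group 4\<^esub> inv\<^bsub>alt_group 4\<^esub> h
        \<and> h \<in> carrier (alt_group 4)"
      using that by (simp only: conj_class_def mem_Collect_eq)
    then obtain h where h: "h \<in> carrier (alt_group 4)"
      "x = h \<otimes>\<^bsub>alt_group 4\<^esub> s \<otimes>\<^bsub>alt_group 4\<^esub> inv\<^bsub>alt_group 4\<^esub> h"
      by (elim exE conjE)
    have "x \<in> carrier (alt_group 4)"
      unfolding h(2) by (intro m_closed inv_closed h(1) klein_carrier(1))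
    then have x: "x permutes {a, b, c, d}"
      by (simp only: alt_group_carrier points)
    have "x \<otimes>\<^bsub>alt_group 4\<^esub> h = h \<otimes>\<^bsub>alt_group 4\<^esub> s"
      unfolding h(2) by (subst m_assoc) (simp_all only: m_closed inv_closed h(1) klein_carrier(1) l_inv r_one)
    then have "x \<circ> h = h \<circ> s"
      by (simp add: alt_group_mult)
    then have xh: "x (h y) = h (s y)" for y
      by (metis comp_apply)
    have hp: "h permutes {a, b, c, d}"
      using h(1) by (simp only: alt_group_carrier points)
    have onto: "\<exists>z\<in>{a, b, c, d}. y = h z" if "y \<in> {a, b, c, d}" for y
      using permutes_image[OF hp] that by (metis imageE)
    have free: "x y \<noteq> y" if y: "y \<in> {a, b, c, d}" for y
    proof -
      obtain z where z: "z \<in> {a, b, c, d}" "y = h z"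
        using onto[OF y] by blast
      have "s z \<noteq> z"
        using z(1) by (elim insertE emptyE) (simp_all add: klein_values neq)
      then show ?thesis
        by (simp add: z(2) xh inj_eq[OF permutes_inj[OF hp]])
    qed
    have invol: "x (x y) = y" if y: "y \<in> {a, b, c, d}" for y
    proof -
      obtain z where "y = h z"
        using onto[OF y] by blast
      then show ?thesis
        using fun_cong[OF klein_mult(1), of z] by (simp add: xh)
    qed
    have inS: "x y \<in> {a, b, c, d}" if "y \<in> {a, b, c, d}" for y
      using permutes_in_image[OF x] that by blast
    have out: "x y = y" if "y \<notin> {a, b, c, d}" for y
      using x that by (rule permutes_not_in)
    have inj: "x y = x z \<longleftrightarrow> y = z" for y z
      by (rule inj_eq[OF permutes_inj[OF x]])
    consider "x a = b" | "x a = c" | "x a = d"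
      using inS[of a] free[of a] by auto
    then show ?thesis
    proof cases
      case 1
      then have "x b = a" using invol[of a] by simp
      moreover then have "x c = d"
        using inS[of c] free[of c] inj[of c a] inj[of c b] 1 neq by auto
      moreover then have "x d = c" using invol[of c] by simp
      ultimately have "x = s"
        using 1 out by (intro pointwise) (auto simp: klein_values klein_outside)
      then show ?thesis by simp
    next
      case 2
      then have "x c = a" using invol[of a] by simp
      moreover then have "x b = d"
        using inS[of b] free[of b] inj[of b a] inj[of b c] 2 neq by auto
      moreover then have "x d = b" using invol[of b] by simp
      ultimately have "x = t1"
        using 2 out by (intro pointwise) (auto simp: klein_values klein_outside)
      then show ?thesis by simp
    next
      case 3
      then have "x d = a" using invol[of a] by simp
      moreover then have "x b = c"
        using inS[of b] free[of b] inj[of b a] inj[of b d] 3 neq by auto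
      moreover then have "x c = b" using invol[of b] by simp
      ultimately have "x = t2"
        using 3 out by (intro pointwise) (auto simp: klein_values klein_outside)
      then show ?thesis by simp
    qed
  qed
  moreover have "s \<in> conj_class (alt_group 4) s"
    using mem[OF one_closed klein_carrier(1)] by (simp add: alt_group_one)
  moreover have "t1 \<in> conj_class (alt_group 4) s"
    using mem[OF klein_carrier(4,2)] klein_conj by simp
  moreover have "t2 \<in> conj_class (alt_group 4) s"
    using mem[OF m_closed[OF klein_carrier(4,4)] klein_carrier(3)] klein_conj
    by (simp add: alt_group_mult)
  ultimately show ?thesis
    by blast
qed

lemma nichols_infinite_dim_klein:
  fixes \<rho> :: "(nat \<Rightarrow> nat) \<Rightarrow> complex ^ 'n ^ 'n::finite"
  assumes irr: "irreducible_rep (alt_group 4) (centralizer (alt_group 4) s) \<rho>"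
    and g: "conj_section (alt_group 4) s g"
  shows "nichols_infinite_dim (yd_basis (alt_group 4) s :: ((nat \<Rightarrow> nat) \<times> 'n) set)
           (yd_braiding (alt_group 4) s g \<rho>)"
proof -
  let ?G = "alt_group 4" and ?C = "centralizer (alt_group 4) s"
  let ?X = "yd_basis (alt_group 4) s :: ((nat \<Rightarrow> nat) \<times> 'n) set"
  let ?q = "yd_matrix (alt_group 4) g \<rho>"
  interpret group ?G
    by (rule alt_group_is_group)
  have comm: "h \<otimes>\<^bsub>?G\<^esub> k = k \<otimes>\<^bsub>?G\<^esub> h" if "h \<in> {id, s, t1, t2}" "k \<in> {id, s, t1, t2}" for h k
    using that klein_mult by (auto simp: alt_group_mult)
  have C: "s \<in> ?C" "t1 \<in> ?C" "t2 \<in> ?C"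
    using klein_carrier klein_mult by (simp_all add: centralizer_def alt_group_mult)
  have inv: "h \<otimes>\<^bsub>?G\<^esub> h = \<one>\<^bsub>?G\<^esub>" if "h \<in> ?C" for h
    using subsetD[OF centralizer_subset_klein that] klein_mult
    by (auto simp: alt_group_mult alt_group_one)
  have scalar: "\<rho> h = mat 1 \<or> \<rho> h = mat (- 1)" if "h \<in> ?C" for h
    using involutive_irreducible_rep[OF is_group subgroup_centralizer[OF klein_carrier(1)] irr inv that] .
  have diag: "diagonal_braiding ?X (yd_braiding ?G s g \<rho>) ?q"
  proof (rule diagonal_yd_braiding[OF g klein_carrier(1)])
    show "\<exists>a. \<rho> h = mat a" if "h \<in> ?C" for h
      using scalar[OF that] by blast
  qed (use comm in \<open>auto simp: conj_class_klein\<close>)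
  have fin: "finite ?X"
    by (simp add: yd_basis_def conj_class_klein)
  have X: "(s, k) \<in> ?X" "(t1, k) \<in> ?X" "(t2, k) \<in> ?X" for k
    by (simp_all add: yd_basis_def conj_class_klein)
  have q_eq: "?q (t, i) (u, k) = \<rho> \<tau> $ k $ k"
    if "t \<in> {s, t1, t2}" "u \<in> {s, t1, t2}" "\<sigma>' \<in> carrier ?G" "\<sigma>' \<circ> s = u \<circ> \<sigma>'" "\<tau> \<in> ?C"
      "t \<circ> \<sigma>' = \<sigma>' \<circ> \<tau>" for t u \<sigma>' \<tau> and i k :: 'n
    using that klein_carrier subsetD[OF centralizer_subset_klein] comm
    by (intro yd_matrix_eq[OF g, where \<sigma> = \<sigma>']) (auto simp: conj_class_klein alt_group_mult)
  \<comment> \<open>The centralizer acts by scalars, so one coordinate of the representation space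
    suffices.\<close>
  fix k :: 'n
  show ?thesis
  proof (cases "\<rho> s = mat 1")
    case True
    have "?q (s, k) (s, k) = 1"
      using q_eq[of s s id s] C True one_closed by (simp add: alt_group_one mat_def)
    then show ?thesis
      using nichols_infinite_dim_point[OF fin diag X(1)] by blast
  next
    case False
    then have s: "\<rho> s = mat (- 1)"
      using scalar C(1) by blast
    obtain \<alpha> \<beta> where t: "\<rho> t1 = mat \<alpha>" "\<rho> t2 = mat \<beta>"
      using scalar C by metis
    have "\<rho> s = \<rho> t1 ** \<rho> t2"
      using irr C klein_mult(8) by (auto simp: irreducible_rep_def linear_rep_def alt_group_mult)
    then have "(mat (- 1) :: complex ^ 'n ^ 'n) $ k $ k = mat (\<alpha> * \<beta>) $ k $ k"
      by (simp add: s t mat_mult_mat)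
    then have \<alpha>\<beta>: "\<alpha> * \<beta> = - 1"
      by (simp add: mat_def)
    have \<sigma>2: "\<sigma> \<circ> \<sigma> \<in> carrier ?G"
      using m_closed[OF klein_carrier(4,4)] by (simp add: alt_group_mult)
    \<comment> \<open>Entries with second index \<open>s\<close>, \<open>t1\<close>,
      \<open>t2\<close> are computed with the conjugators \<open>id\<close>,
      \<open>\<sigma>\<close>, \<open>\<sigma> \<circ> \<sigma>\<close>; the columns are therefore
      cyclic shifts of one another.\<close>
    have q: "?q (s, k) (s, k) = - 1" "?q (t1, k) (s, k) = \<alpha>" "?q (t2, k) (s, k) = \<beta>"
      "?q (s, k) (t1, k) = \<beta>" "?q (t1, k) (t1, k) = - 1" "?q (t2, k) (t1, k) = \<alpha>"
      "?q (s, k) (t2, k) = \<alpha>" "?q (t1, k) (t2, k) = \<beta>" "?q (t2, k) (t2, k) = - 1"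
      using q_eq[of s s id s] q_eq[of t1 s id t1] q_eq[of t2 s id t2]
        q_eq[of s t1 \<sigma> t2] q_eq[of t1 t1 \<sigma> s] q_eq[of t2 t1 \<sigma> t1]
        q_eq[of s t2 "\<sigma> \<circ> \<sigma>" t1] q_eq[of t1 t2 "\<sigma> \<circ> \<sigma>" t2] q_eq[of t2 t2 "\<sigma> \<circ> \<sigma>" s]
        C s t one_closed klein_carrier(4) \<sigma>2 klein_conj by (simp_all add: alt_group_one mat_def)
    show ?thesis
    proof (rule nichols_infinite_dim_triangle[OF fin diag, of "(s, k)" "(t1, k)" "(t2, k)"])
      show "{(s, k), (t1, k), (t2, k)} \<subseteq> ?X"
        using X by simp
      show "distinct [(s, k), (t1, k), (t2, k)]"
        using klein_values neq by auto
    qed (use \<alpha>\<beta> in \<open>auto simp: q mult.commute\<close>)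
  qed
qed

end

theorem proposition2p4:
  fixes \<pi> :: "nat \<Rightarrow> nat"
    and \<rho> :: "(nat \<Rightarrow> nat) \<Rightarrow> complex ^ 'n ^ 'n::finite"
    and g :: "(nat \<Rightarrow> nat) \<Rightarrow> (nat \<Rightarrow> nat)"
  assumes "\<pi> \<in> carrier (alt_group 4)"
    and "double_transposition_type 4 \<pi>"
    and "irreducible_rep (alt_group 4) (centralizer (alt_group 4) \<pi>) \<rho>"
    and "conj_section (alt_group 4) \<pi> g"
  shows "nichols_infinite_dim (yd_basis (alt_group 4) \<pi> :: ((nat \<Rightarrow> nat) \<times> 'n) set)
           (yd_braiding (alt_group 4) \<pi> g \<rho>)"
proof -
  obtain a b c d where abcd: "{a, b, c, d} \<subseteq> {1..4}" "distinct [a, b, c, d]"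
    "\<pi> = Transposition.transpose a b \<circ> Transposition.transpose c d"
    using assms(2) by (auto simp: double_transposition_type_def)
  have "card {a, b, c, d} = card {1..4::nat}"
    using abcd(2) by simp
  then have "{1..4} = {a, b, c, d}"
    using card_subset_eq[OF _ abcd(1)] by simp
  then show ?thesis
    using nichols_infinite_dim_klein[OF _ abcd(2)] assms(3,4) unfolding abcd(3) by blast
qed

end
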